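(* Let $1<\alpha\le 2$ and let $u:\mathbb{Z}^+\to\mathbb{C}$ be a finitely supported function with $|u(0)|=\max_{n\in\mathbb{Z}^+}|u(n)|$. Then $$\sum_{n=1}^\infty|u(n)-u(n-1)|^2 n^\alpha\;\ge\;\frac{(\alpha-1)^2}{4}\sum_{n=1}^\infty|u(n)|^2 n^{\alpha-2}.$$
   Context: $\mathbb{Z}^+=\{0,1,2,\dots\}$. *)

theory Defs
  imports "HOL-Analysis.Analysis"
begin

end

theory Submission imports Defs begin

text \<open>
  Summation by parts against the weight \<open>n powr (\<alpha> - 1)\<close>, whose increments dominate
  \<open>(\<alpha> - 1) * n powr (\<alpha> - 2)\<close> by concavity, moves the difference onto \<open>\<bar>u n\<bar>\<^sup>2\<close>. Since
  \<open>\<bar>x\<bar>\<^sup>2 - \<bar>y\<bar>\<^sup>2 \<le> 2 * \<bar>x\<bar> * \<bar>x - y\<bar>\<close>, AM-GM then absorbs half of the left-hand side.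
\<close>

text \<open>Weighted AM-GM with weights \<open>c\<close> and \<open>1 - c\<close> bounds
  \<open>(m - 1) powr c * m powr (1 - c)\<close> by \<open>m - c\<close>; multiplying by
  \<open>m powr (c - 1)\<close> finishes. Young's inequality needs positive arguments, hence the
  separate case \<open>m = 1\<close>.\<close>

lemma powr_concave_increment:
  fixes c m :: real
  assumes "0 < c" "c \<le> 1" "1 \<le> m"
  shows "(m - 1) powr c + c * m powr (c - 1) \<le> m powr c"
proof -
  have "(m - 1) powr c * m powr (1 - c) \<le> c * (m - 1) + (1 - c) * m"
    using Youngs_inequality_0[of c "1 - c" "m - 1" m] assms by (cases "m = 1") auto
  then have "(m - 1) powr c * m powr (1 - c) * m powr (c - 1) \<le> (m - c) * m powr (c - 1)"
    by (intro mult_right_mono) (auto simp: algebra_simps)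
  moreover have "(m - 1) powr c * m powr (1 - c) * m powr (c - 1) = (m - 1) powr c"
    using assms by (simp add: mult.assoc flip: powr_add)
  moreover have "m * m powr (c - 1) = m powr c"
    using assms by (simp add: powr_mult_base)
  ultimately show ?thesis unfolding left_diff_distrib by linarith
qed

lemma norm_sq_diff_le:
  fixes x y :: "'a::real_normed_vector"
  shows "(norm x)\<^sup>2 - (norm y)\<^sup>2 \<le> 2 * norm x * norm (y - x)"
proof -
  have "\<bar>norm x - norm y\<bar> \<le> norm (y - x)"
    by (metis norm_triangle_ineq3 norm_minus_commute)
  then have "norm x * (norm x - norm y) \<le> norm x * norm (y - x)"
    by (intro mult_left_mono) auto
  moreover have "(norm x)\<^sup>2 - (norm y)\<^sup>2 = 2 * (norm x * (norm x - norm y)) - (norm x - norm y)\<^sup>2"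
    by (simp add: power2_eq_square algebra_simps)
  moreover have "0 \<le> (norm x - norm y)\<^sup>2" by simp
  ultimately show ?thesis by linarith
qed

text \<open>AM-GM with parameter e = \<open>c / 2\<close>: absorbing e out of the \<open>c\<close>
  supplied by concavity leaves the final constant e * (c - e), which is largest, namely
  \<open>c\<^sup>2 / 4\<close>, at this choice.\<close>

lemma weighted_norm_sq_diff_le:
  fixes x y :: "'a::real_normed_vector" and c m :: real
  assumes "0 < c" "0 < m"
  shows "m powr c * ((norm x)\<^sup>2 - (norm y)\<^sup>2)
    \<le> c / 2 * (m powr (c - 1) * (norm x)\<^sup>2) + 2 / c * (m powr (c + 1) * (norm (y - x))\<^sup>2)"
proof -
  let ?a = "norm x" and ?d = "norm (y - x)" and ?p = "m powr (c - 1)"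
  have p: "m powr c = m * ?p" "m powr (c + 1) = m\<^sup>2 * ?p"
    using assms by (simp_all add: powr_diff powr_add power2_eq_square)
  have "m * (?a\<^sup>2 - (norm y)\<^sup>2) \<le> m * (2 * ?a * ?d)"
    using norm_sq_diff_le[of x y] assms by (intro mult_left_mono) auto
  also have "\<dots> \<le> c / 2 * ?a\<^sup>2 + 2 / c * (m\<^sup>2 * ?d\<^sup>2)"
  proof -
    \<comment> \<open>The square whose expansion has cross term \<open>2 * m * ?a * ?d\<close> and
      diagonal coefficients \<open>c / 2\<close> and \<open>2 / c\<close>.\<close>
    have "0 \<le> (c * ?a - 2 * m * ?d)\<^sup>2 / (2 * c)" using assms by simp
    also have "\<dots> = c / 2 * ?a\<^sup>2 + 2 / c * (m\<^sup>2 * ?d\<^sup>2) - m * (2 * ?a * ?d)"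
      using assms by (simp add: field_simps power2_eq_square)
    finally show ?thesis by simp
  qed
  finally have "?p * (m * (?a\<^sup>2 - (norm y)\<^sup>2)) \<le> ?p * (c / 2 * ?a\<^sup>2 + 2 / c * (m\<^sup>2 * ?d\<^sup>2))"
    by (intro mult_left_mono) auto
  then show ?thesis unfolding p by (simp add: algebra_simps)
qed

text \<open>Summation by parts done as an induction: the last summand is the boundary term, which
  has weight 0 at \<open>N = 0\<close> and is passed on from \<open>u (Suc N)\<close> to
  \<open>u (Suc (Suc N))\<close> at each step.\<close>

lemma hardy_partial_sum:
  fixes u :: "nat \<Rightarrow> 'a::real_normed_vector" and c :: real
  assumes c: "0 < c" "c \<le> 1"
  shows "c / 2 * (\<Sum>n=1..N. real n powr (c - 1) * (norm (u n))\<^sup>2)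
    \<le> 2 / c * (\<Sum>n=1..N. real n powr (c + 1) * (norm (u (Suc n) - u n))\<^sup>2)
      + real N powr c * (norm (u (Suc N)))\<^sup>2"
proof (induction N)
  case 0
  then show ?case by simp
next
  case (Suc N)
  let ?m = "real (Suc N)" and ?x = "u (Suc N)" and ?y = "u (Suc (Suc N))"
  \<comment> \<open>Raising the old boundary weight to \<open>?m powr c\<close> pays for
    \<open>c\<close> times the new left-hand term; trading \<open>?x\<close> for \<open>?y\<close>
    costs half of that, so \<open>c / 2\<close> survives.\<close>
  have "(real N powr c + c * ?m powr (c - 1)) * (norm ?x)\<^sup>2 \<le> ?m powr c * (norm ?x)\<^sup>2"
    using powr_concave_increment[OF c, of ?m] by (intro mult_right_mono) auto
  with weighted_norm_sq_diff_le[OF c(1), of ?m ?x ?y] Suc.IH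
  show ?case by (simp add: algebra_simps)
qed

theorem theorem4p8:
  fixes \<alpha> :: real and u :: "nat \<Rightarrow> complex"
  assumes "1 < \<alpha>" and "\<alpha> \<le> 2"
    and "finite {n. u n \<noteq> 0}"
    and "norm (u 0) = Max (range (\<lambda>n. norm (u n)))"
  shows "(\<Sum>\<^sub>\<infinity>n\<in>{1..}. (norm (u n - u (n - 1)))\<^sup>2 * real n powr \<alpha>)
       \<ge> (\<alpha> - 1)\<^sup>2 / 4 * (\<Sum>\<^sub>\<infinity>n\<in>{1..}. (norm (u n))\<^sup>2 * real n powr (\<alpha> - 2))"
proof -
  define c where "c = \<alpha> - 1"
  have c: "0 < c" "c \<le> 1" and \<alpha>: "\<alpha> = c + 1" using assms(1,2) by (auto simp: c_def)
  obtain N where N: "\<And>n. n > N \<Longrightarrow> u n = 0"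
    using assms(3) unfolding finite_nat_set_iff_bounded_le
    by (auto simp flip: linorder_not_le)
  let ?A = "\<Sum>n=1..N. real n powr (c - 1) * (norm (u n))\<^sup>2"
  let ?B = "\<Sum>n=1..N. real n powr (c + 1) * (norm (u (Suc n) - u n))\<^sup>2"
  have A: "(\<Sum>\<^sub>\<infinity>n\<in>{1..}. (norm (u n))\<^sup>2 * real n powr (\<alpha> - 2)) = ?A"
  proof -
    have "(\<Sum>\<^sub>\<infinity>n\<in>{1..}. (norm (u n))\<^sup>2 * real n powr (\<alpha> - 2))
        = (\<Sum>\<^sub>\<infinity>n\<in>{1..N}. real n powr (c - 1) * (norm (u n))\<^sup>2)"
      by (rule infsum_cong_neutral) (auto simp: N \<alpha>)
    then show ?thesis by simp
  qed
  \<comment> \<open>The boundary term vanishes because \<open>u (Suc N) = 0\<close>.\<close>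
  have "c / 2 * ?A \<le> 2 / c * ?B"
    using hardy_partial_sum[OF c, where N = N and u = u] N by simp
  then have "c / 2 * (c / 2 * ?A) \<le> c / 2 * (2 / c * ?B)"
    using c by (intro mult_left_mono) auto
  then have "c\<^sup>2 / 4 * ?A \<le> ?B"
    using c by (simp add: power2_eq_square)
  \<comment> \<open>\<open>?B\<close> weights the jump from \<open>n\<close> to \<open>Suc n\<close>
    by its left endpoint, the goal by its right one; the weight is increasing.\<close>
  also have "?B \<le> (\<Sum>n=1..N. real (Suc n) powr (c + 1) * (norm (u (Suc n) - u n))\<^sup>2)"
    using c by (intro sum_mono mult_right_mono powr_mono2) auto
  also have "\<dots> = (\<Sum>n=Suc 1..Suc N. (norm (u n - u (n - 1)))\<^sup>2 * real n powr \<alpha>)"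
    unfolding sum.shift_bounds_cl_Suc_ivl by (simp add: \<alpha> mult.commute)
  \<comment> \<open>Adds the nonnegative first jump, from \<open>u 0\<close> to
    \<open>u 1\<close>.\<close>
  also have "\<dots> \<le> (\<Sum>n=1..Suc N. (norm (u n - u (n - 1)))\<^sup>2 * real n powr \<alpha>)"
    by (intro sum_mono2) auto
  also have "\<dots> = (\<Sum>\<^sub>\<infinity>n\<in>{1..Suc N}. (norm (u n - u (n - 1)))\<^sup>2 * real n powr \<alpha>)"
    by simp
  \<comment> \<open>The cutoff is \<open>Suc N\<close>, not \<open>N\<close>: the jump from
    \<open>u N\<close> down to 0 may still count.\<close>
  also have "\<dots> = (\<Sum>\<^sub>\<infinity>n\<in>{1..}. (norm (u n - u (n - 1)))\<^sup>2 * real n powr \<alpha>)"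
    by (rule infsum_cong_neutral) (auto simp: N)
  finally show ?thesis unfolding A c_def .
qed

end
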